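(* Let $(X,\mathcal{I})$ be a matroid on a finite set $X$ and $f:\mathcal{I}\rightarrow\mathbb{R}$ a polymatroid function. Assume that a polymatroid extension $g:2^X\rightarrow\mathbb{R}$ of $f$ exists (i.e. $g$ is a polymatroid function on $2^X$ with $g(A)=f(A)$ for all $A\in\mathcal{I}$). Then $b(f)\leq c(g)$, where $b(f)$ is the partial curvature of $f$ and $c(g)$ is the total curvature of $g$.
   Context: A function $h:\mathcal{J}\rightarrow\mathbb{R}$, where $\mathcal{J}$ is the collection of independent sets of a matroid on $X$ (including $\mathcal{J}=2^X$), is a polymatroid function if $h(\emptyset)=0$, $h$ is monotone ($h(A)\leq h(B)$ for all $A\subseteq B$ with $A,B\in\mathcal{J}$), and $h$ is submodular ($h(A\cup\{j\})-h(A)\geq h(B\cup\{j\})-h(B)$ for all $A\subseteq B$ and $j\in X\setminus B$ with $B\cup\{j\}\in\mathcal{J}$). The partial curvature of $f:\mathcal{I}\rightarrow\mathbb{R}$ is $$b(f)=\max_{j,A:\ j\in A\in\mathcal{I},\ f(\{j\})\neq f(\emptyset)}\left\{1-\frac{f(A)-f(A\setminus\{j\})}{f(\{j\})-f(\emptyset)}\right\},$$ and the total curvature of $g:2^X\rightarrow\mathbb{R}$ is $$c(g)=\max_{j\in X,\ g(\{j\})\neq g(\emptyset)}\left\{1-\frac{g(X)-g(X\setminus\{j\})}{g(\{j\})-g(\emptyset)}\right\}.$$ It is assumed that $f(\{j\})\neq 0$ for some $\{j\}\in\mathcal{I}$, so that both maxima are over nonempty sets. *)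

theory Defs
  imports Complex_Main
begin

locale matroid =
  fixes X :: "'a set" and \<I> :: "'a set set"
  assumes finite_ground: "finite X"
    and indep_subset: "A \<in> \<I> \<Longrightarrow> A \<subseteq> X"
    and indep_empty: "{} \<in> \<I>"
    and indep_hereditary: "B \<in> \<I> \<Longrightarrow> A \<subseteq> B \<Longrightarrow> A \<in> \<I>"
    and indep_augment: "A \<in> \<I> \<Longrightarrow> B \<in> \<I> \<Longrightarrow> card A < card B \<Longrightarrow> \<exists>x \<in> B - A. A \<union> {x} \<in> \<I>"

lemma matroid_Pow:
  assumes "finite X"
  shows "matroid X (Pow X)"
proof
  fix A B assume A: "A \<in> Pow X" and B: "B \<in> Pow X" and lt: "card A < card B"
  have "finite A" using A assms by (auto intro: finite_subset)
  then have "\<not> B \<subseteq> A" using lt card_mono leD by blast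
  then show "\<exists>x \<in> B - A. A \<union> {x} \<in> Pow X" using A B by blast
qed (use assms in auto)

text \<open>A real function on a family \<open>\<J>\<close> of sets is a total function on \<open>'a set\<close> whose values
  outside \<open>\<J>\<close> are irrelevant. When \<open>matroid X \<J>\<close> holds, \<open>B \<union> {j} \<in> \<J>\<close> already puts every set
  occurring in the submodularity condition into \<open>\<J>\<close>.\<close>

definition polymatroid_function :: "'a set \<Rightarrow> 'a set set \<Rightarrow> ('a set \<Rightarrow> real) \<Rightarrow> bool" where
  "polymatroid_function X \<J> h \<longleftrightarrow>
     h {} = 0 \<and>
     (\<forall>A \<in> \<J>. \<forall>B \<in> \<J>. A \<subseteq> B \<longrightarrow> h A \<le> h B) \<and>
     (\<forall>A B j. A \<subseteq> B \<and> j \<in> X - B \<and> B \<union> {j} \<in> \<J> \<longrightarrow>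
        h (A \<union> {j}) - h A \<ge> h (B \<union> {j}) - h B)"

definition polymatroid_extension ::
    "'a set \<Rightarrow> 'a set set \<Rightarrow> ('a set \<Rightarrow> real) \<Rightarrow> ('a set \<Rightarrow> real) \<Rightarrow> bool" where
  "polymatroid_extension X \<I> f g \<longleftrightarrow>
     polymatroid_function X (Pow X) g \<and> (\<forall>A \<in> \<I>. g A = f A)"

text \<open>Both maxima are meaningful only over nonempty finite sets: \<open>X\<close> must be finite and some
  singleton (in \<open>\<I>\<close>, respectively in \<open>Pow X\<close>) must have a value different from that of \<open>{}\<close>.\<close>

definition partial_curvature :: "'a set set \<Rightarrow> ('a set \<Rightarrow> real) \<Rightarrow> real" where
  "partial_curvature \<I> f =
     Max {1 - (f A - f (A - {j})) / (f {j} - f {}) | j A. j \<in> A \<and> A \<in> \<I> \<and> f {j} \<noteq> f {}}"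

definition total_curvature :: "'a set \<Rightarrow> ('a set \<Rightarrow> real) \<Rightarrow> real" where
  "total_curvature X g =
     Max {1 - (g X - g (X - {j})) / (g {j} - g {}) | j. j \<in> X \<and> g {j} \<noteq> g {}}"

end

theory Submission
  imports Defs
begin

text \<open>By submodularity the marginal value of \<open>j\<close> over \<open>A - {j}\<close> is at least its marginal value
  over \<open>X - {j}\<close>, so each term of the partial curvature is bounded by the term of the total
  curvature with the same \<open>j\<close>.\<close>

lemma polymatroid_curvature_term_le:
  assumes g: "polymatroid_function X (Pow X) g" and A: "A \<subseteq> X" "j \<in> A"
  shows "1 - (g A - g (A - {j})) / (g {j} - g {}) \<le> 1 - (g X - g (X - {j})) / (g {j} - g {})"
proof -
  \<comment> \<open>Submodularity is applied to the pair \<open>A - {j}\<close>,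
    \<open>X - {j}\<close>, so that adding \<open>j\<close> back gives \<open>A\<close> and
    \<open>X\<close>.\<close>
  have "A - {j} \<subseteq> X - {j}" "j \<in> X - (X - {j})" "(X - {j}) \<union> {j} \<in> Pow X"
    using A by auto
  then have "g ((A - {j}) \<union> {j}) - g (A - {j}) \<ge> g ((X - {j}) \<union> {j}) - g (X - {j})"
    using g unfolding polymatroid_function_def by presburger
  moreover have "(A - {j}) \<union> {j} = A" "(X - {j}) \<union> {j} = X"
    using A by auto
  ultimately have "g X - g (X - {j}) \<le> g A - g (A - {j})"
    by simp
  moreover have "{} \<in> Pow X" "{j} \<in> Pow X"
    using A by auto
  \<comment> \<open>The common denominator is nonnegative, so division keeps the order. If it is
    zero, both quotients are 0 by the convention \<open>x / 0 = 0\<close>.\<close>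
  then have "g {} \<le> g {j}"
    using g unfolding polymatroid_function_def by (meson empty_subsetI)
  ultimately show ?thesis
    by (simp add: divide_right_mono)
qed

lemma total_curvature_ge:
  assumes "finite X" "j \<in> X" "g {j} \<noteq> g {}"
  shows "1 - (g X - g (X - {j})) / (g {j} - g {}) \<le> total_curvature X g"
  unfolding total_curvature_def using assms by (intro Max_ge) auto

theorem theorem6:
  fixes X :: "'a set" and \<I> :: "'a set set" and f g :: "'a set \<Rightarrow> real"
  assumes "matroid X \<I>"
    and "polymatroid_function X \<I> f"
    and "polymatroid_extension X \<I> f g"
    and "\<exists>j. {j} \<in> \<I> \<and> f {j} \<noteq> 0"
  shows "partial_curvature \<I> f \<le> total_curvature X g"
proof -
  interpret matroid X \<I> by fact
  let ?S = "{1 - (f A - f (A - {j})) / (f {j} - f {}) | j A. j \<in> A \<and> A \<in> \<I> \<and> f {j} \<noteq> f {}}"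
  have g: "polymatroid_function X (Pow X) g" and ext: "\<And>A. A \<in> \<I> \<Longrightarrow> g A = f A"
    using assms(3) by (auto simp: polymatroid_extension_def)
  have "f {} = 0"
    using assms(2) by (simp add: polymatroid_function_def)
  \<comment> \<open>The singleton supplied by the last assumption is used with
    \<open>A = {j}\<close>. Nonemptiness and finiteness of \<open>?S\<close> are what give
    \<open>Max\<close> its meaning.\<close>
  then have "?S \<noteq> {}"
    using assms(4) by auto
  moreover have "?S \<subseteq> (\<lambda>(j, A). 1 - (f A - f (A - {j})) / (f {j} - f {})) ` (X \<times> Pow X)"
  proof
    fix x assume "x \<in> ?S"
    then obtain j A where "x = 1 - (f A - f (A - {j})) / (f {j} - f {})" "j \<in> A" "A \<in> \<I>"
      by blast
    then show "x \<in> (\<lambda>(j, A). 1 - (f A - f (A - {j})) / (f {j} - f {})) ` (X \<times> Pow X)"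
      using indep_subset by (intro image_eqI[of _ _ "(j, A)"]) auto
  qed
  then have "finite ?S"
    by (rule finite_subset) (simp add: finite_ground)
  moreover have "1 - (f A - f (A - {j})) / (f {j} - f {}) \<le> total_curvature X g"
    if A: "j \<in> A" "A \<in> \<I>" and f: "f {j} \<noteq> f {}" for j A
  proof -
    \<comment> \<open>Heredity keeps every set in the term inside \<open>\<I>\<close>, where
      \<open>g\<close> agrees with \<open>f\<close>, so the term for \<open>f\<close> is literally
      the term for \<open>g\<close>.\<close>
    have "A - {j} \<in> \<I>" "{j} \<in> \<I>"
      using A by (auto intro: indep_hereditary)
    then have eq: "f A = g A" "f (A - {j}) = g (A - {j})" "f {j} = g {j}" "f {} = g {}"
      using ext A indep_empty by simp_all
    have X: "A \<subseteq> X" "j \<in> X"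
      using A indep_subset by blast+
    have "g {j} \<noteq> g {}"
      using f eq by simp
    from polymatroid_curvature_term_le[OF g X(1) A(1)] total_curvature_ge[OF finite_ground X(2) this]
    show ?thesis
      unfolding eq by (rule order_trans)
  qed
  \<comment> \<open>A maximum over a finite nonempty set is bounded once each element is.\<close>
  ultimately show ?thesis
    unfolding partial_curvature_def by (subst Max_le_iff) auto
qed

end
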